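(* Let $x_{ij}\in\{1,\dots,C_j\}$ ($1\le i\le n$, $1\le j\le m$) be categorical data in which every category of every variable is observed at least once. Let $A$ be its indicator matrix, $p$ its vector of category proportions, and $D_p=\mathrm{diag}(p)$. Then the one-step likelihood estimate for the multilogit-bilinear model with rank constraint $K$, obtained by expanding the log-likelihood around the independence model $(\beta_0=\log p,\ \Gamma_0=0)$, is $(\beta_0,\widehat\Gamma_{\mathrm{MCA}})$, where $$\widehat\Gamma_{\mathrm{MCA}}=U_KD_KV_K^T$$ is the MCA decomposition, i.e. the rank-$K$ truncated singular value decomposition of $$Z_A=\frac{1}{\sqrt{mn}}(A-\mathbf 1p^T)D_p^{-1/2}.$$
   Context: Data: $n$ individuals and $m$ categorical variables; variable $j$ has $C_j$ categories, $C=\sum_{j=1}^m C_j$, and $x_{ij}\in\{1,\dots,C_j\}$ is the response of individual $i$ to variable $j$. $K\ge 1$ is an integer. Indicator matrix: $A=[A^1|\cdots|A^m]\in\{0,1\}^{n\times C}$, where $A^j\in\{0,1\}^{n\times C_j}$ has entries $A_i^j(c)=1$ if $x_{ij}=c$ and $0$ otherwise. Proportions: $p^j\in\mathbb R^{C_j}$ has entries $p^j(c)=\frac1n\sum_{i=1}^n A_i^j(c)$. $p\in\mathbb R^C$ is the concatenation of $p^1,\dots,p^m$, all of whose entries are positive because every category is observed. $\log p$ is taken entrywise, $D_p=\mathrm{diag}(p)\in\mathbb R^{C\times C}$, and $\mathbf 1\in\mathbb R^n$ is the all-ones vector. Multilogit-bilinear model: the parameters are $\beta=(\beta^j(c))_{j,c}\in\mathbb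 R^C$ and $\Gamma=[\Gamma^1\cdots\Gamma^m]\in\mathbb R^{n\times C}$, where $\Gamma^j\in\mathbb R^{n\times C_j}$ has entries $\Gamma_i^j(c)$. The $x_{ij}$ are independent with $$P(x_{ij}=c)=\frac{e^{\beta^j(c)+\Gamma_i^j(c)}}{\sum_{c'=1}^{C_j}e^{\beta^j(c')+\Gamma_i^j(c')}}.$$ The interaction $\Gamma$ is constrained by $\mathrm{rank}(\Gamma)\le K$ and by the identifiability constraint $\Gamma^jp^j=0$ for each $j$, i.e. $\sum_c\Gamma_i^j(c)p^j(c)=0$ for all $i,j$. The log-likelihood is $$\ell(\beta,\Gamma)=\sum_{i=1}^n\sum_{j=1}^m\left[\beta^j(x_{ij})+\Gamma_i^j(x_{ij})-\log\left(\sum_{c=1}^{C_j}e^{\beta^j(c)+\Gamma_i^j(c)}\right)\right].$$ One-step likelihood estimate: with $\zeta=(\beta,\mathrm{vec}(\Gamma))$ and $\zeta_0=(\beta_0,0)$, let $\tilde\ell$ be the second-order Taylor approximation $$\tilde\ell(\beta,\Gamma)=\ell(\zeta_0)+\ell'(\zeta_0)^T(\zeta-\zeta_0)+\tfrac12(\zeta-\zeta_0)^T\ell''(\zeta_0)(\zeta-\zeta_0).$$ The one-step estimate is the maximizer of $\tilde\ell$, in place of $\ell$, subject to the model's constraints on $\Gamma$. MCA: multiple correspondence analysis of the indicator matrix forms the pseudo-residual matrix $Z_A=\frac1{\sqrt{mn}}(A-\mathbf 1p^T)D_p^{-1/2}$ and takes its singular value decomposition $Z_A=UDV^T$ ($U,V$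 with orthonormal columns, $D$ diagonal with the singular values in decreasing order). $U_K,V_K$ are the first $K$ columns of $U,V$, and $D_K$ is the diagonal matrix of the $K$ largest singular values.
   Formalization: The printed formula fails entrywise; proved with Γ̂ = √(mn) U_K D_K V_K^T D_p^{-1/2}. The maximizer (β,Γ) is not unique: it is shown to be a maximizer for every SVD, and the fitted probabilities are shown to be unique when the rank-K truncation is determined. *)

theory Defs
  imports "HOL-Analysis.Analysis"
begin

(* Encoding of the data. Individuals are the elements of the finite type 'n, variables those of
   'm, and 'c is the disjoint union over the variables of their sets of categories, so that
   CARD('n) = n, CARD('m) = m and CARD('c) = C = C_1 + ... + C_m. The map var :: 'c => 'm sends
   a category to the variable it belongs to: {c. var c = j} is the set of the C_j categories of
   variable j, and the block of index j of a vector in R^C or of a matrix in R^(n x C) consists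
   of the entries whose column index c satisfies var c = j. The response of individual i to
   variable j is x i j, with var (x i j) = j. *)

definition categorical_data :: "('c \<Rightarrow> 'm) \<Rightarrow> ('n \<Rightarrow> 'm \<Rightarrow> 'c) \<Rightarrow> bool" where
  "categorical_data var x \<longleftrightarrow> (\<forall>i j. var (x i j) = j)"

definition all_categories_observed :: "('c \<Rightarrow> 'm) \<Rightarrow> ('n \<Rightarrow> 'm \<Rightarrow> 'c) \<Rightarrow> bool" where
  "all_categories_observed var x \<longleftrightarrow> (\<forall>c. \<exists>i. x i (var c) = c)"

definition indicator_matrix ::
    "('c::finite \<Rightarrow> 'm) \<Rightarrow> ('n::finite \<Rightarrow> 'm \<Rightarrow> 'c) \<Rightarrow> real^'c^'n" where
  "indicator_matrix var x = (\<chi> i c. if x i (var c) = c then 1 else 0)"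

definition proportions ::
    "('c::finite \<Rightarrow> 'm) \<Rightarrow> ('n::finite \<Rightarrow> 'm \<Rightarrow> 'c) \<Rightarrow> real^'c" where
  "proportions var x = (\<chi> c. (\<Sum>i\<in>UNIV. indicator_matrix var x $ i $ c) / real CARD('n))"

definition log_proportions ::
    "('c::finite \<Rightarrow> 'm) \<Rightarrow> ('n::finite \<Rightarrow> 'm \<Rightarrow> 'c) \<Rightarrow> real^'c" where
  "log_proportions var x = (\<chi> c. ln (proportions var x $ c))"

definition diag_matrix :: "real^'c \<Rightarrow> real^'c^'c" where
  "diag_matrix w = (\<chi> a b. if a = b then w $ a else 0)"


section \<open>The multilogit-bilinear model\<close>

definition model_prob ::
    "('c::finite \<Rightarrow> 'm) \<Rightarrow> (real^'c) \<times> (real^'c^'n) \<Rightarrow> 'n \<Rightarrow> 'c \<Rightarrow> real" where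
  "model_prob var = (\<lambda>(\<beta>, \<Gamma>) i c.
     exp (\<beta> $ c + \<Gamma> $ i $ c) / (\<Sum>c' | var c' = var c. exp (\<beta> $ c' + \<Gamma> $ i $ c')))"

definition loglik ::
    "('c::finite \<Rightarrow> 'm::finite) \<Rightarrow> ('n::finite \<Rightarrow> 'm \<Rightarrow> 'c) \<Rightarrow> (real^'c) \<times> (real^'c^'n) \<Rightarrow> real" where
  "loglik var x = (\<lambda>(\<beta>, \<Gamma>). \<Sum>i\<in>UNIV. \<Sum>j\<in>UNIV.
     \<beta> $ x i j + \<Gamma> $ i $ x i j - ln (\<Sum>c | var c = j. exp (\<beta> $ c + \<Gamma> $ i $ c)))"

definition model_constraints ::
    "('c::finite \<Rightarrow> 'm) \<Rightarrow> real^'c \<Rightarrow> nat \<Rightarrow> (real^'c) \<times> (real^'c^'n) \<Rightarrow> bool" where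
  "model_constraints var p K = (\<lambda>(\<beta>, \<Gamma>).
     rank \<Gamma> \<le> K \<and> (\<forall>i j. (\<Sum>c | var c = j. \<Gamma> $ i $ c * p $ c) = 0))"

(* The quadratic term is the Hessian form (z - z0)^T f''(z0) (z - z0), written as the derivative
   at z0, in the direction h = z - z0, of the first derivative of f in the direction h. *)
definition taylor2 :: "('a::real_normed_vector \<Rightarrow> real) \<Rightarrow> 'a \<Rightarrow> 'a \<Rightarrow> real" where
  "taylor2 f z0 z =
     f z0 + frechet_derivative f (at z0) (z - z0)
     + 1 / 2 * frechet_derivative (\<lambda>w. frechet_derivative f (at w) (z - z0)) (at z0) (z - z0)"

definition one_step_estimate ::
    "('c::finite \<Rightarrow> 'm::finite) \<Rightarrow> ('n::finite \<Rightarrow> 'm \<Rightarrow> 'c) \<Rightarrow> nat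
      \<Rightarrow> (real^'c) \<times> (real^'c^'n) \<Rightarrow> (real^'c) \<times> (real^'c^'n) \<Rightarrow> bool" where
  "one_step_estimate var x K \<zeta>0 \<zeta> \<longleftrightarrow>
     is_arg_max (taylor2 (loglik var x) \<zeta>0) (model_constraints var (proportions var x) K) \<zeta>"


section \<open>Multiple correspondence analysis\<close>

definition pseudo_residual ::
    "('c::finite \<Rightarrow> 'm::finite) \<Rightarrow> ('n::finite \<Rightarrow> 'm \<Rightarrow> 'c) \<Rightarrow> real^'c^'n" where
  "pseudo_residual var x =
     (1 / sqrt (real CARD('m) * real CARD('n))) *\<^sub>R
       ((indicator_matrix var x - (\<chi> i. proportions var x))
          ** diag_matrix (\<chi> c. 1 / sqrt (proportions var x $ c)))"

(* For r columns U 0, ..., U (r - 1) and V 0, ..., V (r - 1) and the diagonal matrix D with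
   diagonal entries d 0, ..., d (r - 1), the product of the first K columns of U, the leading
   K x K block of D and the transpose of the first K columns of V. There are only min K r
   columns to take when K > r. For K = r it is the whole product U D V^T. *)
definition truncated_product ::
    "nat \<Rightarrow> nat \<Rightarrow> (nat \<Rightarrow> real^'n) \<Rightarrow> (nat \<Rightarrow> real) \<Rightarrow> (nat \<Rightarrow> real^'c) \<Rightarrow> real^'c^'n" where
  "truncated_product K r U d V = (\<chi> i c. \<Sum>k<min K r. U k $ i * d k * V k $ c)"

definition orthonormal_columns :: "nat \<Rightarrow> (nat \<Rightarrow> 'a::real_inner) \<Rightarrow> bool" where
  "orthonormal_columns r U \<longleftrightarrow> (\<forall>k<r. \<forall>l<r. U k \<bullet> U l = (if k = l then 1 else 0))"

definition is_svd ::
    "real^'c^'n \<Rightarrow> nat \<Rightarrow> (nat \<Rightarrow> real^'n::finite) \<Rightarrow> (nat \<Rightarrow> real) \<Rightarrow> (nat \<Rightarrow> real^'c::finite) \<Rightarrow> bool" where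
  "is_svd Z r U d V \<longleftrightarrow>
     orthonormal_columns r U \<and> orthonormal_columns r V \<and>
     (\<forall>k<r. 0 \<le> d k) \<and> (\<forall>k l. k \<le> l \<longrightarrow> l < r \<longrightarrow> d l \<le> d k) \<and>
     Z = truncated_product r r U d V"

(* An interaction matrix Gamma in R^(n x C) has the coordinates (1/sqrt(mn)) Gamma D_p^(1/2) in
   the normalisation of MCA, the one that turns the fitted A - 1 p^T = Gamma D_p of the
   linearised model into Z_A. This is the inverse map: it gives the Gamma whose MCA
   coordinates are M. *)
definition from_mca_coordinates ::
    "('c::finite \<Rightarrow> 'm::finite) \<Rightarrow> ('n::finite \<Rightarrow> 'm \<Rightarrow> 'c) \<Rightarrow> real^'c^'n \<Rightarrow> real^'c^'n" where
  "from_mca_coordinates var x M =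
     sqrt (real CARD('m) * real CARD('n)) *\<^sub>R
       (M ** diag_matrix (\<chi> c. 1 / sqrt (proportions var x $ c)))"

end

theory Submission
  imports Defs
begin

text \<open>Around the independence model the Hessian of the log-likelihood is, up to sign, the variance
  of the linear predictor within each block under the proportions \<open>p\<close>, so it only sees the
  predictor after centring within blocks. Completing the square then turns the
  Taylor approximation into a constant minus \<open>mn/2 \<parallel>Z - Y\<parallel>\<^sup>2\<close>, where \<open>Y\<close> is the block-centred
  predictor in the normalisation of MCA. The matrix \<open>Y\<close> may have rank \<open>K + 1\<close> because of the
  contribution of \<open>\<beta>\<close>, which has constant rows. The columns of \<open>Z\<close> sum to zero, hence subtracting
  the mean row from \<open>Y\<close> only brings it closer to \<open>Z\<close> and leaves a matrix of rank at most \<open>K\<close>,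
  to which the Eckart--Young theorem applies.\<close>

section \<open>The Eckart--Young theorem for the Frobenius norm\<close>

lemma power2_norm_eq_sum_rows:
  fixes A :: "real^'c::finite^'n::finite"
  shows "(norm A)\<^sup>2 = (\<Sum>i\<in>UNIV. (norm (A $ i))\<^sup>2)"
  by (simp add: power2_norm_eq_inner inner_vec_def)

lemma power2_norm_orthonormal_sum:
  assumes "orthonormal_columns r V"
  shows "(norm (\<Sum>k<r. a k *\<^sub>R V k))\<^sup>2 = (\<Sum>k<r. (a k)\<^sup>2)"
proof -
  have "(norm (\<Sum>k<r. a k *\<^sub>R V k))\<^sup>2 = (\<Sum>k<r. \<Sum>l<r. a k * (a l * (V k \<bullet> V l)))"
    by (simp add: power2_norm_eq_inner inner_sum_left inner_sum_right sum_distrib_left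
        inner_commute mult.left_commute)
  also have "\<dots> = (\<Sum>k<r. \<Sum>l<r. if k = l then (a k)\<^sup>2 else 0)"
    using assms by (intro sum.cong) (auto simp: orthonormal_columns_def power2_eq_square)
  also have "\<dots> = (\<Sum>k<r. (a k)\<^sup>2)"
    by simp
  finally show ?thesis .
qed

text \<open>A coefficient formula rather than a map onto a subspace; it is the orthogonal projection
  onto the span only once \<open>e\<close> is orthonormal.\<close>

definition projection :: "nat \<Rightarrow> (nat \<Rightarrow> 'a::real_inner) \<Rightarrow> 'a \<Rightarrow> 'a" where
  "projection s e v = (\<Sum>l<s. (e l \<bullet> v) *\<^sub>R e l)"

lemma projection_residual_orthogonal:
  assumes "orthonormal_columns s e" and "y \<in> span (e ` {..<s})"
  shows "orthogonal (v - projection s e v) y"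
proof -
  have "orthogonal (v - projection s e v) w" if w: "w \<in> e ` {..<s}" for w
  proof -
    from w obtain k where k: "k < s" "w = e k" by auto
    have "projection s e v \<bullet> e k = (\<Sum>l<s. if k = l then e k \<bullet> v else 0)"
      unfolding projection_def inner_sum_left using assms(1) k
      by (intro sum.cong) (auto simp: orthonormal_columns_def)
    then show ?thesis
      using k by (simp add: orthogonal_def inner_diff_left inner_diff_right inner_commute)
  qed
  then show ?thesis
    using assms(2) orthogonal_to_span by blast
qed

lemma projection_in_span: "projection s e v \<in> span (e ` {..<s})"
  unfolding projection_def by (intro span_sum span_scale span_base) auto

lemma power2_norm_projection:
  assumes "orthonormal_columns s e"
  shows "(norm (projection s e v))\<^sup>2 = (\<Sum>l<s. (e l \<bullet> v)\<^sup>2)"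
  unfolding projection_def by (rule power2_norm_orthonormal_sum[OF assms])

text \<open>Pythagoras for \<open>v - w\<close> and for \<open>v\<close>, both split at the
  projection of \<open>v\<close>. Only the last term depends on \<open>w\<close>, and it vanishes
  exactly when \<open>w\<close> is the projection.\<close>

lemma power2_dist_span:
  assumes "orthonormal_columns s e" and "w \<in> span (e ` {..<s})"
  shows "(norm (v - w))\<^sup>2 =
    (norm v)\<^sup>2 - (\<Sum>l<s. (e l \<bullet> v)\<^sup>2) + (norm (projection s e v - w))\<^sup>2"
proof -
  let ?P = "projection s e v"
  have "orthogonal (v - ?P) (?P - w)" "orthogonal (v - ?P) ?P"
    using assms by (auto intro!: projection_residual_orthogonal span_diff projection_in_span)
  from this[THEN norm_add_Pythagorean] show ?thesis
    using power2_norm_projection[OF assms(1), of v] by simp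
qed

lemma bessel_inequality:
  assumes "orthonormal_columns s e"
  shows "(\<Sum>l<s. (e l \<bullet> v)\<^sup>2) \<le> (norm v)\<^sup>2"
proof -
  have "(norm (v - projection s e v))\<^sup>2 = (norm v)\<^sup>2 - (\<Sum>l<s. (e l \<bullet> v)\<^sup>2)"
    using power2_dist_span[OF assms projection_in_span, of v v] by simp
  then show ?thesis
    using zero_le_power2[of "norm (v - projection s e v)"] by linarith
qed

lemma orthonormal_columns_norm:
  "orthonormal_columns r V \<Longrightarrow> k < r \<Longrightarrow> (norm (V k))\<^sup>2 = 1"
  by (simp add: orthonormal_columns_def power2_norm_eq_inner)

section \<open>Row spaces and rank\<close>

lemma rows_eq_range: "rows A = range (($) A)"
  by (auto simp: rows_def row_def vec_nth_inverse)

text \<open>Turns a rank bound into the form used below: all rows lie in the span of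
  \<open>rank M\<close> orthonormal vectors.\<close>

lemma orthonormal_row_space:
  fixes M :: "real^'c::finite^'n::finite"
  obtains e where "orthonormal_columns (rank M) e"
    and "\<And>i. M $ i \<in> span (e ` {..<rank M})"
proof -
  obtain B where B: "pairwise orthogonal B" "\<And>x. x \<in> B \<Longrightarrow> norm x = 1" "independent B"
      "card B = dim (span (rows M))" "span B = span (rows M)"
    using orthonormal_basis_subspace[OF subspace_span[of "rows M"]] by metis
  have "finite B" using B(3) independent_imp_finite by blast
  then obtain e where e: "bij_betw e {..<rank M} B"
    using ex_bij_betw_nat_finite[of B] B(4)
    by (auto simp: row_rank_def atLeast0LessThan)
  have "orthonormal_columns (rank M) e"
    unfolding orthonormal_columns_def
  proof (intro allI impI)
    fix k l assume kl: "k < rank M" "l < rank M"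
    then have eB: "e k \<in> B" "e l \<in> B" using e by (auto simp: bij_betw_def)
    show "e k \<bullet> e l = (if k = l then 1 else 0)"
    proof (cases "k = l")
      case True
      then show ?thesis using B(2)[OF eB(1)] by (simp add: norm_eq_1)
    next
      case False
      then have "e k \<noteq> e l" using e kl by (auto simp: bij_betw_def inj_on_def)
      then show ?thesis
        using pairwiseD[OF B(1) eB] False by (simp add: orthogonal_def)
    qed
  qed
  moreover have "M $ i \<in> span (e ` {..<rank M})" for i
  proof -
    have "M $ i \<in> rows M" by (simp add: rows_eq_range)
    then show ?thesis using e B(5) by (simp add: bij_betw_def span_base)
  qed
  ultimately show thesis using that by blast
qed

lemma rank_le_if_rows_in_span:
  fixes M :: "real^'c::finite^'n::finite"
  assumes "\<And>i. M $ i \<in> span W" and "finite W"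
  shows "rank M \<le> card W"
  unfolding row_rank_def using assms
  by (intro dim_le_card) (auto simp: rows_eq_range)

section \<open>Truncated singular value decompositions\<close>

lemma truncated_product_row:
  "truncated_product K r U d V $ i = (\<Sum>k<min K r. (U k $ i * d k) *\<^sub>R V k)"
  by (simp add: truncated_product_def vec_eq_iff)

text \<open>Zeroing the tail of \<open>d\<close> keeps the length \<open>r\<close>, so the facts
  about full products with arbitrary weights also cover truncations and residuals.\<close>

lemma truncated_product_zero_tail:
  "truncated_product K r U d V = truncated_product r r U (\<lambda>k. if k < K then d k else 0) V"
proof -
  have "{..<r} \<inter> {k. k < K} = {..<min K r}" by auto
  then show ?thesis
    by (simp add: truncated_product_def vec_eq_iff if_distrib[where f="\<lambda>z. _ * z"]
        if_distrib[where f="\<lambda>z. z * _"] sum.If_cases cong: if_cong)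
qed

lemma truncated_product_residual:
  "truncated_product r r U d V - truncated_product K r U d V =
    truncated_product r r U (\<lambda>k. if k < K then 0 else d k) V"
  unfolding truncated_product_zero_tail[of K]
  by (simp add: truncated_product_def vec_eq_iff flip: sum_subtractf)
    (auto intro!: sum.cong)

text \<open>The numbers being squared are the entries of the matrix applied to \<open>e\<close>, and
  this vector has coordinates \<open>d k * (e \<bullet> V k)\<close> in the orthonormal family
  \<open>U\<close>.\<close>

lemma sum_power2_inner_rows:
  assumes "orthonormal_columns r U"
  shows "(\<Sum>i\<in>UNIV. (e \<bullet> truncated_product r r U d V $ i)\<^sup>2) = (\<Sum>k<r. (d k * (e \<bullet> V k))\<^sup>2)"
proof -
  have "(\<Sum>i\<in>UNIV. (e \<bullet> truncated_product r r U d V $ i)\<^sup>2)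
      = (norm (\<Sum>k<r. (d k * (e \<bullet> V k)) *\<^sub>R U k))\<^sup>2"
    unfolding power2_norm_eq_inner inner_vec_def[of "\<Sum>k<r. _ k *\<^sub>R U k"]
    by (simp add: truncated_product_row inner_sum_right power2_eq_square mult_ac)
  then show ?thesis
    using power2_norm_orthonormal_sum[OF assms] by simp
qed

lemma power2_norm_truncated_product:
  assumes "orthonormal_columns r U" and "orthonormal_columns r V"
  shows "(norm (truncated_product r r U d V))\<^sup>2 = (\<Sum>k<r. (d k)\<^sup>2)"
proof -
  have "(norm (truncated_product r r U d V))\<^sup>2 = (\<Sum>i\<in>UNIV. \<Sum>k<r. (U k $ i * d k)\<^sup>2)"
    by (simp add: power2_norm_eq_sum_rows truncated_product_row
        power2_norm_orthonormal_sum[OF assms(2)])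
  also have "\<dots> = (\<Sum>k<r. (d k)\<^sup>2 * (\<Sum>i\<in>UNIV. (U k $ i)\<^sup>2))"
    by (subst sum.swap) (simp add: power_mult_distrib sum_distrib_left mult.commute)
  also have "\<dots> = (\<Sum>k<r. (d k)\<^sup>2)"
    using orthonormal_columns_norm[OF assms(1)]
    unfolding power2_norm_eq_inner inner_vec_def by (simp add: power2_eq_square)
  finally show ?thesis .
qed

text \<open>Pythagoras in every row, after which the mass captured by the projection is rewritten
  through the right singular vectors. The chosen subspace then enters the first sum only through the
  squared norms of the projected \<open>V k\<close>.\<close>

lemma power2_dist_low_rank:
  fixes M :: "real^'c::finite^'n::finite"
  assumes svd: "is_svd Z r U d V" and e: "orthonormal_columns s e"
    and M: "\<And>i. M $ i \<in> span (e ` {..<s})"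
  shows "(norm (Z - M))\<^sup>2 = (\<Sum>k<r. (d k)\<^sup>2 * (1 - (norm (projection s e (V k)))\<^sup>2))
    + (\<Sum>i\<in>UNIV. (norm (projection s e (Z $ i) - M $ i))\<^sup>2)"
proof -
  have U: "orthonormal_columns r U" and V: "orthonormal_columns r V"
    and Z: "Z = truncated_product r r U d V"
    using svd by (auto simp: is_svd_def)
  have "(\<Sum>i\<in>UNIV. \<Sum>l<s. (e l \<bullet> Z $ i)\<^sup>2) = (\<Sum>l<s. \<Sum>k<r. (d k * (e l \<bullet> V k))\<^sup>2)"
    unfolding Z by (subst sum.swap) (simp add: sum_power2_inner_rows[OF U])
  also have "\<dots> = (\<Sum>k<r. (d k)\<^sup>2 * (norm (projection s e (V k)))\<^sup>2)"
    by (subst sum.swap) (simp add: power2_norm_projection[OF e] power_mult_distrib sum_distrib_left)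
  finally show ?thesis
    using power2_norm_truncated_product[OF U V, of d] power2_norm_eq_sum_rows[of Z]
    unfolding power2_norm_eq_sum_rows[of "Z - M"] vector_minus_component
      power2_dist_span[OF e M, of "Z $ _"]
    by (simp add: sum.distrib sum_subtractf right_diff_distrib flip: Z)
qed

text \<open>A trace bound: after swapping the sums, Bessel for \<open>V\<close> lets each unit
  vector \<open>e l\<close> contribute at most 1.\<close>

lemma sum_power2_norm_projection_le:
  assumes "orthonormal_columns s e" and "orthonormal_columns r V"
  shows "(\<Sum>k<r. (norm (projection s e (V k)))\<^sup>2) \<le> real s"
proof -
  have "(\<Sum>k<r. (norm (projection s e (V k)))\<^sup>2) = (\<Sum>l<s. \<Sum>k<r. (V k \<bullet> e l)\<^sup>2)"
    by (subst sum.swap) (simp add: power2_norm_projection[OF assms(1)] inner_commute)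
  also have "\<dots> \<le> (\<Sum>l<s. 1)"
    using bessel_inequality[OF assms(2)] orthonormal_columns_norm[OF assms(1)]
    by (intro sum_mono) (metis lessThan_iff)
  finally show ?thesis by simp
qed

lemma norm_projection_le_1:
  assumes "orthonormal_columns s e" and "orthonormal_columns r V" and "k < r"
  shows "(norm (projection s e (V k)))\<^sup>2 \<le> 1"
  using bessel_inequality[OF assms(1), of "V k"] orthonormal_columns_norm[OF assms(2,3)]
  by (simp add: power2_norm_projection[OF assms(1)])

text \<open>Any level \<open>\<mu>\<close> separating the first \<open>K\<close> squared singular values from the others
  writes the excess of the residual as a sum of nonnegative terms.\<close>

lemma residual_excess:
  fixes M :: "real^'c::finite^'n::finite"
  assumes svd: "is_svd Z r U d V" and e: "orthonormal_columns s e"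
    and M: "\<And>i. M $ i \<in> span (e ` {..<s})" and "K < r"
  shows "(norm (Z - M))\<^sup>2 - (norm (Z - truncated_product K r U d V))\<^sup>2 =
    (\<Sum>k<r. if k < K then ((d k)\<^sup>2 - \<mu>) * (1 - (norm (projection s e (V k)))\<^sup>2)
            else (\<mu> - (d k)\<^sup>2) * (norm (projection s e (V k)))\<^sup>2)
    + \<mu> * (real K - (\<Sum>k<r. (norm (projection s e (V k)))\<^sup>2))
    + (\<Sum>i\<in>UNIV. (norm (projection s e (Z $ i) - M $ i))\<^sup>2)"
proof -
  define t where "t k = (norm (projection s e (V k)))\<^sup>2" for k
  have "{..<r} \<inter> {k. k < K} = {..<K}" using \<open>K < r\<close> by auto
  then have K: "(\<Sum>k<r. if k < K then 1 else 0::real) = real K"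
    by (simp add: sum.If_cases)
  have res: "(norm (Z - truncated_product K r U d V))\<^sup>2 = (\<Sum>k<r. (if k < K then 0 else d k)\<^sup>2)"
    using svd truncated_product_residual[of r U d V K]
    by (simp add: is_svd_def power2_norm_truncated_product)
  \<comment> \<open>Writing \<open>K\<close> as a sum of indicators makes this an identity term by
    term in \<open>k\<close>.\<close>
  have "(\<Sum>k<r. (d k)\<^sup>2 * (1 - t k)) - (\<Sum>k<r. (if k < K then 0 else d k)\<^sup>2)
      - \<mu> * ((\<Sum>k<r. if k < K then 1 else 0) - (\<Sum>k<r. t k)) =
      (\<Sum>k<r. if k < K then ((d k)\<^sup>2 - \<mu>) * (1 - t k) else (\<mu> - (d k)\<^sup>2) * t k)"
    unfolding sum_subtractf[symmetric] sum_distrib_left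
    by (intro sum.cong) (auto simp: algebra_simps)
  then show ?thesis
    unfolding power2_dist_low_rank[OF svd e M] res K t_def by linarith
qed

lemma svd_antimono_power2:
  assumes "is_svd Z r U d V" and "k \<le> l" and "l < r"
  shows "(d l)\<^sup>2 \<le> (d k)\<^sup>2"
  using assms by (intro power_mono) (auto simp: is_svd_def)

text \<open>Every squared projection norm lies between 0 and 1, and together they sum to at most
  \<open>s \<le> K\<close>. The weak inequalities on \<mu> admit both a level equal to a squared
  singular value and one strictly inside a gap.\<close>

lemma residual_excess_terms_nonneg:
  assumes "orthonormal_columns s e" "orthonormal_columns r V" and "s \<le> K" and "0 \<le> \<mu>"
    and "\<And>k. k < K \<Longrightarrow> \<mu> \<le> (d k)\<^sup>2" and "\<And>k. K \<le> k \<Longrightarrow> k < r \<Longrightarrow> (d k)\<^sup>2 \<le> \<mu>"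
  shows "k < r \<Longrightarrow> 0 \<le> (if k < K then ((d k)\<^sup>2 - \<mu>) * (1 - (norm (projection s e (V k)))\<^sup>2)
            else (\<mu> - (d k)\<^sup>2) * (norm (projection s e (V k)))\<^sup>2)"
    and "0 \<le> \<mu> * (real K - (\<Sum>k<r. (norm (projection s e (V k)))\<^sup>2))"
proof -
  show "0 \<le> \<mu> * (real K - (\<Sum>k<r. (norm (projection s e (V k)))\<^sup>2))"
    using sum_power2_norm_projection_le[OF assms(1,2)] \<open>s \<le> K\<close>
    by (intro mult_nonneg_nonneg \<open>0 \<le> \<mu>\<close>) linarith
  show "0 \<le> (if k < K then ((d k)\<^sup>2 - \<mu>) * (1 - (norm (projection s e (V k)))\<^sup>2)
            else (\<mu> - (d k)\<^sup>2) * (norm (projection s e (V k)))\<^sup>2)" if "k < r"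
    using assms(5)[of k] assms(6)[of k] that norm_projection_le_1[OF assms(1,2) that]
    by (simp add: mult_nonneg_nonneg)
qed

theorem eckart_young:
  fixes M :: "real^'c::finite^'n::finite"
  assumes svd: "is_svd Z r U d V" and rk: "rank M \<le> K"
  shows "(norm (Z - truncated_product K r U d V))\<^sup>2 \<le> (norm (Z - M))\<^sup>2"
proof (cases "K < r")
  case True
  obtain e where e: "orthonormal_columns (rank M) e" "\<And>i. M $ i \<in> span (e ` {..<rank M})"
    using orthonormal_row_space by blast
  have V: "orthonormal_columns r V" using svd by (simp add: is_svd_def)
  \<comment> \<open>The first discarded squared singular value separates kept from discarded ones
    even if there is a tie.\<close>
  have bounds: "\<And>k. k < K \<Longrightarrow> (d K)\<^sup>2 \<le> (d k)\<^sup>2"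
      "\<And>k. K \<le> k \<Longrightarrow> k < r \<Longrightarrow> (d k)\<^sup>2 \<le> (d K)\<^sup>2"
    using svd_antimono_power2[OF svd] True by auto
  have "0 \<le> (\<Sum>k<r. if k < K
        then ((d k)\<^sup>2 - (d K)\<^sup>2) * (1 - (norm (projection (rank M) e (V k)))\<^sup>2)
        else ((d K)\<^sup>2 - (d k)\<^sup>2) * (norm (projection (rank M) e (V k)))\<^sup>2)"
    by (rule sum_nonneg, rule residual_excess_terms_nonneg(1)[OF e(1) V rk zero_le_power2 bounds])
      simp_all
  moreover have "0 \<le> (\<Sum>i\<in>UNIV. (norm (projection (rank M) e (Z $ i) - M $ i))\<^sup>2)"
    by (intro sum_nonneg) simp
  ultimately show ?thesis
    using residual_excess[OF svd e True, of "(d K)\<^sup>2"]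
      residual_excess_terms_nonneg(2)[where d=d, OF e(1) V rk zero_le_power2 bounds]
    by linarith
next
  case False
  then show ?thesis
    using svd truncated_product_residual[of r U d V K]
    by (simp add: is_svd_def truncated_product_def min_def split: if_splits)
qed

text \<open>A strict gap leaves room for a level strictly between the two groups of squared singular
  values, so zero excess determines every projected \<open>V k\<close>. In the other cases all
  discarded singular values vanish and the truncation is \<open>Z\<close> itself.\<close>

theorem eckart_young_unique:
  fixes M :: "real^'c::finite^'n::finite"
  assumes svd: "is_svd Z r U d V" and rk: "rank M \<le> K" and "K \<ge> 1"
    and gap: "r \<le> K \<or> d K < d (K - 1) \<or> d K = 0"
    and le: "(norm (Z - M))\<^sup>2 \<le> (norm (Z - truncated_product K r U d V))\<^sup>2"
  shows "M = truncated_product K r U d V"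
proof -
  have Z: "Z = truncated_product r r U d V" and V: "orthonormal_columns r V"
    using svd by (auto simp: is_svd_def)
  show ?thesis
  proof (cases "K < r \<and> d K \<noteq> 0")
    case False
    have "d k = 0" if "K \<le> k" "k < r" for k
    proof -
      have "0 \<le> d k" "d k \<le> d K" using that svd by (auto simp: is_svd_def)
      then show ?thesis using that False by auto
    qed
    then have "Z - truncated_product K r U d V = 0"
      unfolding Z truncated_product_residual
      by (auto simp: truncated_product_def vec_eq_iff intro!: sum.neutral)
    then show ?thesis using le by auto
  next
    case True
    with gap have "K < r" and dK: "d K < d (K - 1)" by auto
    obtain e where e: "orthonormal_columns (rank M) e" "\<And>i. M $ i \<in> span (e ` {..<rank M})"
      using orthonormal_row_space by blast
    let ?P = "projection (rank M) e"
    \<comment> \<open>The midpoint of the gap makes both separation inequalities strict.\<close>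
    define \<mu> where "\<mu> = ((d K)\<^sup>2 + (d (K - 1))\<^sup>2) / 2"
    have "(d K)\<^sup>2 < (d (K - 1))\<^sup>2"
      using dK svd \<open>K < r\<close> by (intro power_strict_mono) (auto simp: is_svd_def)
    then have "(d K)\<^sup>2 < \<mu>" "\<mu> < (d (K - 1))\<^sup>2" by (auto simp: \<mu>_def)
    have "0 \<le> \<mu>" by (simp add: \<mu>_def)
    have \<mu>: "\<And>k. k < K \<Longrightarrow> \<mu> < (d k)\<^sup>2" "\<And>k. K \<le> k \<Longrightarrow> k < r \<Longrightarrow> (d k)\<^sup>2 < \<mu>"
    proof -
      fix k
      show "\<mu> < (d k)\<^sup>2" if "k < K"
      proof -
        have "k \<le> K - 1" "K - 1 < r" using that \<open>K < r\<close> by linarith+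
        then show ?thesis
          using svd_antimono_power2[OF svd] \<open>\<mu> < (d (K - 1))\<^sup>2\<close> by (meson less_le_trans)
      qed
      show "(d k)\<^sup>2 < \<mu>" if "K \<le> k" "k < r"
        using svd_antimono_power2[OF svd that] \<open>(d K)\<^sup>2 < \<mu>\<close> by simp
    qed
    define g where "g k = (if k < K then ((d k)\<^sup>2 - \<mu>) * (1 - (norm (?P (V k)))\<^sup>2)
        else (\<mu> - (d k)\<^sup>2) * (norm (?P (V k)))\<^sup>2)" for k
    have g: "\<And>k. k < r \<Longrightarrow> 0 \<le> g k"
      and tr: "0 \<le> \<mu> * (real K - (\<Sum>k<r. (norm (?P (V k)))\<^sup>2))"
      unfolding g_def
      by (rule residual_excess_terms_nonneg[where d=d, OF e(1) V rk \<open>0 \<le> \<mu>\<close>];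
          simp add: \<mu> less_imp_le)+
    define h where "h i = (norm (?P (Z $ i) - M $ i))\<^sup>2" for i
    have "0 \<le> (\<Sum>k<r. g k)" "0 \<le> (\<Sum>i\<in>UNIV. h i)"
      using g by (auto simp: h_def intro!: sum_nonneg)
    then have "(\<Sum>k<r. g k) = 0" "(\<Sum>i\<in>UNIV. h i) = 0"
      using residual_excess[OF svd e \<open>K < r\<close>, of \<mu>] le tr
      unfolding g_def[symmetric] h_def[symmetric] by linarith+
    then have g0: "g k = 0" if "k < r" for k
      using g that sum_nonneg_eq_0_iff[of "{..<r}" g] by auto
    have h0: "h i = 0" for i
      using \<open>(\<Sum>i\<in>UNIV. h i) = 0\<close> sum_nonneg_eq_0_iff[of UNIV h] by (simp add: h_def)
    \<comment> \<open>For \<open>k < K\<close> the projection has the full norm of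
      \<open>V k\<close>, so \<open>V k\<close> lies in the span by Pythagoras; for the remaining
      \<open>k\<close> it has norm 0.\<close>
    have PV: "?P (V k) = (if k < K then V k else 0)" if "k < r" for k
    proof (cases "k < K")
      case True
      then have "(norm (?P (V k)))\<^sup>2 = 1"
        using g0[OF that] \<mu>(1) by (auto simp: g_def)
      then have "(norm (V k - ?P (V k)))\<^sup>2 = 0"
        using power2_dist_span[OF e(1) projection_in_span, of "V k" "V k"]
          power2_norm_projection[OF e(1), of "V k"] orthonormal_columns_norm[OF V that] by simp
      then show ?thesis using True by simp
    next
      case False
      then show ?thesis
        using g0[OF that] \<mu>(2)[of k] that by (auto simp: g_def)
    qed
    have "M $ i = truncated_product K r U d V $ i" for i
    proof -
      \<comment> \<open>Projecting the singular expansion of a row of \<open>Z\<close> keeps exactly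
        its first \<open>K\<close> terms, and \<open>h0\<close> identifies the projected row with
        that of \<open>M\<close>.\<close>
      have "linear ?P"
        unfolding projection_def
        by (intro linear_compose_sum ballI bounded_linear.linear bounded_linear_intros)
      then have "?P (Z $ i) = (\<Sum>k<r. (U k $ i * d k) *\<^sub>R ?P (V k))"
        by (simp add: Z truncated_product_row linear_sum linear_scale)
      also have "\<dots> = truncated_product K r U d V $ i"
        unfolding truncated_product_zero_tail[of K] truncated_product_row
        by (intro sum.cong) (auto simp: PV)
      finally show ?thesis using h0[of i] by (simp add: h_def)
    qed
    then show ?thesis by (simp add: vec_eq_iff)
  qed
qed

section \<open>The quadratic approximation of the likelihood\<close>

text \<open>As a bounded linear functional of the whole parameter it is its own derivative, which
  reduces differentiating the likelihood to log-sum-exp.\<close>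

definition predictor :: "'n \<Rightarrow> 'c \<Rightarrow> (real^'c::finite) \<times> (real^'c^'n::finite) \<Rightarrow> real" where
  "predictor i c \<zeta> = fst \<zeta> $ c + snd \<zeta> $ i $ c"

lemma has_derivative_predictor [derivative_intros]:
  "(predictor i c has_derivative predictor i c) F"
proof -
  have "bounded_linear (predictor i c)"
    unfolding predictor_def
    by (intro bounded_linear_add bounded_linear_compose[OF bounded_linear_vec_nth]
        bounded_linear_fst bounded_linear_snd)
  then show ?thesis by (rule bounded_linear_imp_has_derivative)
qed

lemma loglik_predictor:
  "loglik var x w = (\<Sum>i\<in>UNIV. \<Sum>j\<in>UNIV.
     predictor i (x i j) w - ln (\<Sum>c | var c = j. exp (predictor i c w)))"
  by (cases w) (simp add: loglik_def predictor_def)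

lemma model_prob_predictor:
  "model_prob var \<zeta> i c =
    exp (predictor i c \<zeta>) / (\<Sum>c' | var c' = var c. exp (predictor i c' \<zeta>))"
  by (cases \<zeta>) (simp add: model_prob_def predictor_def)

lemma block_sum_exp_pos:
  assumes "categorical_data var x"
  shows "0 < (\<Sum>c::'c::finite | var c = j. exp (f c :: real))"
  using assms by (intro sum_pos) (auto simp: categorical_data_def)

lemma loglik_has_derivative:
  assumes "categorical_data var x"
  shows "(loglik var x has_derivative (\<lambda>h. \<Sum>i\<in>UNIV. \<Sum>j\<in>UNIV. predictor i (x i j) h
      - (\<Sum>c | var c = j. exp (predictor i c w) * predictor i c h)
        / (\<Sum>c | var c = j. exp (predictor i c w)))) (at w)"
  unfolding loglik_predictor[abs_def]
  apply (rule derivative_eq_intros refl block_sum_exp_pos[OF assms])+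
  apply (simp add: divide_inverse mult.commute)
  done

text \<open>The direction \<open>h\<close> stays fixed, as \<open>taylor2\<close> requires. The
  result is minus the sum of the within-block softmax covariances of the predictors of
  \<open>h\<close> and \<open>k\<close>.\<close>

lemma loglik_has_second_derivative:
  assumes "categorical_data var x"
  shows "((\<lambda>w. \<Sum>i\<in>UNIV. \<Sum>j\<in>UNIV. predictor i (x i j) h
      - (\<Sum>c | var c = j. exp (predictor i c w) * predictor i c h)
        / (\<Sum>c | var c = j. exp (predictor i c w))) has_derivative
      (\<lambda>k. \<Sum>i\<in>UNIV. \<Sum>j\<in>UNIV.
        (\<Sum>c | var c = j. exp (predictor i c w) * predictor i c h)
        * (\<Sum>c | var c = j. exp (predictor i c w) * predictor i c k)
        / (\<Sum>c | var c = j. exp (predictor i c w))\<^sup>2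
      - (\<Sum>c | var c = j. exp (predictor i c w) * predictor i c k * predictor i c h)
        / (\<Sum>c | var c = j. exp (predictor i c w)))) (at w)"
  apply (rule derivative_eq_intros refl block_sum_exp_pos[OF assms, THEN less_imp_neq, THEN not_sym])+
  using block_sum_exp_pos[OF assms, THEN less_imp_neq, THEN not_sym]
  apply (auto simp: divide_simps power2_eq_square fun_eq_iff intro!: sum.cong)
  apply (simp add: mult.commute)
  done

section \<open>Category proportions and the expansion at independence\<close>

lemma proportions_pos:
  assumes "all_categories_observed var x"
  shows "0 < proportions var x $ c"
proof -
  obtain i where "x i (var c) = c"
    using assms by (auto simp: all_categories_observed_def)
  then have "0 < (\<Sum>i\<in>UNIV. indicator_matrix var x $ i $ c)"
    by (intro sum_pos2[of _ i]) (auto simp: indicator_matrix_def)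
  then show ?thesis by (simp add: proportions_def)
qed

lemma block_sum_indicator:
  assumes "categorical_data var x"
  shows "(\<Sum>c | var c = j. indicator_matrix var x $ i $ c * f c) = f (x i j)"
proof -
  have "(\<Sum>c | var c = j. indicator_matrix var x $ i $ c * f c)
      = (\<Sum>c | var c = j. if x i j = c then f c else 0)"
    by (intro sum.cong) (auto simp: indicator_matrix_def)
  also have "\<dots> = f (x i j)"
    using assms by (simp add: categorical_data_def)
  finally show ?thesis .
qed

lemma block_sum_proportions:
  fixes x :: "'n::finite \<Rightarrow> 'm \<Rightarrow> 'c::finite"
  assumes "categorical_data var x"
  shows "(\<Sum>c | var c = j. proportions var x $ c) = 1"
proof -
  have "(\<Sum>c | var c = j. proportions var x $ c)
      = (\<Sum>i\<in>UNIV. \<Sum>c | var c = j. indicator_matrix var x $ i $ c * 1) / real CARD('n)"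
    by (simp add: proportions_def sum_divide_distrib[symmetric]) (rule sum.swap)
  then show ?thesis
    unfolding block_sum_indicator[OF assms] by simp
qed

lemma taylor2_loglik_predictor:
  assumes cat: "categorical_data var x" and obs: "all_categories_observed var x"
  defines "z0 \<equiv> (log_proportions var x, 0)" and "p \<equiv> proportions var x"
  shows "taylor2 (loglik var x) z0 z = loglik var x z0 + (\<Sum>i\<in>UNIV. \<Sum>j\<in>UNIV.
      predictor i (x i j) (z - z0) - (\<Sum>c | var c = j. p $ c * predictor i c (z - z0))
      + ((\<Sum>c | var c = j. p $ c * predictor i c (z - z0))\<^sup>2
        - (\<Sum>c | var c = j. p $ c * (predictor i c (z - z0))\<^sup>2)) / 2)"
proof -
  \<comment> \<open>At independence the softmax weights are the proportions themselves, and the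
    denominators are 1 by \<open>p1\<close>.\<close>
  have ep: "exp (predictor i c z0) = p $ c" for i c
    using proportions_pos[OF obs, of c]
    by (simp add: predictor_def z0_def p_def log_proportions_def)
  have p1: "(\<Sum>c | var c = j. p $ c) = 1" for j
    unfolding p_def by (rule block_sum_proportions[OF cat])
  show ?thesis
    unfolding taylor2_def loglik_has_derivative[OF cat, THEN frechet_derivative_at, symmetric]
      loglik_has_second_derivative[OF cat, THEN frechet_derivative_at, symmetric] ep p1
    by (simp add: sum.distrib sum_subtractf sum_divide_distrib diff_divide_distrib
        power2_eq_square mult.assoc)
qed

text \<open>Removes the within-block constant, to which the fitted probabilities are blind.\<close>

definition block_centred :: "('c::finite \<Rightarrow> 'm) \<Rightarrow> real^'c \<Rightarrow> ('c \<Rightarrow> real) \<Rightarrow> 'c \<Rightarrow> real" where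
  "block_centred var p y c = y c - (\<Sum>c' | var c' = var c. p $ c' * y c')"

text \<open>The scaling makes minus the Hessian form equal to \<open>mn\<close> times the squared
  Frobenius norm. At \<beta> = log p and under the identifiability constraint it inverts
  \<open>from_mca_coordinates\<close>.\<close>

definition mca_coordinates ::
    "('c::finite \<Rightarrow> 'm::finite) \<Rightarrow> ('n::finite \<Rightarrow> 'm \<Rightarrow> 'c) \<Rightarrow> (real^'c) \<times> (real^'c^'n) \<Rightarrow> real^'c^'n" where
  "mca_coordinates var x \<zeta> = (\<chi> i c. sqrt (proportions var x $ c) / sqrt (real CARD('m) * real CARD('n))
     * block_centred var (proportions var x) (\<lambda>c. predictor i c (\<zeta> - (log_proportions var x, 0))) c)"

lemma matrix_mul_diag_matrix: "(A ** diag_matrix w) $ i $ c = A $ i $ c * w $ c"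
  by (simp add: matrix_matrix_mult_def diag_matrix_def if_distrib cong: if_cong)

lemma pseudo_residual_entry:
  fixes x :: "'n::finite \<Rightarrow> 'm::finite \<Rightarrow> 'c::finite"
  shows "pseudo_residual var x $ i $ c = (indicator_matrix var x $ i $ c - proportions var x $ c)
    / (sqrt (real CARD('m) * real CARD('n)) * sqrt (proportions var x $ c))"
  by (simp add: pseudo_residual_def matrix_mul_diag_matrix)

lemma block_sum_centred:
  assumes "(\<Sum>c | var c = j. p $ c) = 1"
  shows "(\<Sum>c | var c = j. p $ c * block_centred var p y c) = 0"
    and "(\<Sum>c | var c = j. p $ c * (block_centred var p y c)\<^sup>2) =
      (\<Sum>c | var c = j. p $ c * (y c)\<^sup>2) - (\<Sum>c | var c = j. p $ c * y c)\<^sup>2"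
proof -
  define \<mu> where "\<mu> = (\<Sum>c | var c = j. p $ c * y c)"
  have bc: "block_centred var p y c = y c - \<mu>" if "var c = j" for c
    using that by (simp add: block_centred_def \<mu>_def)
  have "(\<Sum>c | var c = j. p $ c * block_centred var p y c)
      = (\<Sum>c | var c = j. p $ c * y c) - (\<Sum>c | var c = j. p $ c) * \<mu>"
    unfolding sum_distrib_right sum_subtractf[symmetric]
    by (intro sum.cong) (auto simp: bc algebra_simps)
  then show "(\<Sum>c | var c = j. p $ c * block_centred var p y c) = 0"
    by (simp add: assms \<mu>_def)
  have "(\<Sum>c | var c = j. p $ c * (block_centred var p y c)\<^sup>2)
      = (\<Sum>c | var c = j. p $ c * (y c)\<^sup>2) - (\<Sum>c | var c = j. p $ c * y c) * (2 * \<mu>)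
        + (\<Sum>c | var c = j. p $ c) * \<mu>\<^sup>2"
    unfolding sum_distrib_right sum_subtractf[symmetric] sum.distrib[symmetric]
    by (intro sum.cong) (auto simp: bc power2_eq_square algebra_simps)
  then show "(\<Sum>c | var c = j. p $ c * (block_centred var p y c)\<^sup>2) =
      (\<Sum>c | var c = j. p $ c * (y c)\<^sup>2) - (\<Sum>c | var c = j. p $ c * y c)\<^sup>2"
    by (simp add: assms \<mu>_def power2_eq_square)
qed

lemma taylor2_loglik:
  fixes var :: "'c::finite \<Rightarrow> 'm::finite" and x :: "'n::finite \<Rightarrow> 'm \<Rightarrow> 'c"
  assumes cat: "categorical_data var x" and obs: "all_categories_observed var x"
  defines "z0 \<equiv> (log_proportions var x, 0)"
  shows "taylor2 (loglik var x) z0 \<zeta> = loglik var x z0 + real CARD('m) * real CARD('n) / 2 *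
    ((norm (pseudo_residual var x))\<^sup>2 - (norm (pseudo_residual var x - mca_coordinates var x \<zeta>))\<^sup>2)"
proof -
  define p where "p = proportions var x"
  define A where "A = indicator_matrix var x"
  define N where "N = real CARD('m) * real CARD('n)"
  define Z where "Z = pseudo_residual var x"
  define Y where "Y = mca_coordinates var x \<zeta>"
  define y where "y i c = predictor i c (\<zeta> - z0)" for i c
  define y' where "y' i = block_centred var p (y i)" for i
  have p: "0 < p $ c" for c unfolding p_def by (rule proportions_pos[OF obs])
  have p1: "(\<Sum>c | var c = j. p $ c) = 1" for j
    unfolding p_def by (rule block_sum_proportions[OF cat])
  have N: "0 < N" by (simp add: N_def)
  \<comment> \<open>Completing the square in one entry: the linear term is \<open>N * Z * Y\<close>
    and the quadratic one is \<open>N * Y^2 / 2\<close>.\<close>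
  have entry: "(A $ i $ c - p $ c) * y' i c - p $ c * (y' i c)\<^sup>2 / 2
      = N / 2 * ((Z $ i $ c)\<^sup>2 - (Z $ i $ c - Y $ i $ c)\<^sup>2)" for i c
  proof -
    have Y: "Y $ i $ c = sqrt (p $ c) / sqrt N * y' i c"
      by (simp add: Y_def mca_coordinates_def p_def N_def y'_def y_def[abs_def] z0_def)
    have Z: "Z $ i $ c = (A $ i $ c - p $ c) / (sqrt N * sqrt (p $ c))"
      by (simp add: Z_def pseudo_residual_entry p_def N_def A_def)
    have "N * (Z $ i $ c * Y $ i $ c) = (A $ i $ c - p $ c) * y' i c"
    proof -
      have "Z $ i $ c * Y $ i $ c = (A $ i $ c - p $ c) * y' i c / (sqrt N * sqrt N)"
        using p[of c] by (simp add: Y Z)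
      then show ?thesis using N by simp
    qed
    moreover have "N * (Y $ i $ c)\<^sup>2 = p $ c * (y' i c)\<^sup>2"
      using p[of c] N unfolding Y by (simp add: power_mult_distrib power_divide)
    ultimately show ?thesis by (simp add: power2_eq_square algebra_simps)
  qed
  have block: "y i (x i j) - (\<Sum>c | var c = j. p $ c * y i c)
      + ((\<Sum>c | var c = j. p $ c * y i c)\<^sup>2 - (\<Sum>c | var c = j. p $ c * (y i c)\<^sup>2)) / 2
      = (\<Sum>c | var c = j. N / 2 * ((Z $ i $ c)\<^sup>2 - (Z $ i $ c - Y $ i $ c)\<^sup>2))" for i j
  proof -
    have "var (x i j) = j" using cat by (simp add: categorical_data_def)
    \<comment> \<open>The weighted sum of the centred predictor is 0; subtracting it is what
      produces the factor \<open>A - p\<close>.\<close>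
    then have "y i (x i j) - (\<Sum>c | var c = j. p $ c * y i c)
        = (\<Sum>c | var c = j. A $ i $ c * y' i c) - (\<Sum>c | var c = j. p $ c * y' i c)"
      unfolding A_def block_sum_indicator[OF cat] y'_def
      by (simp add: block_sum_centred(1)[OF p1]) (simp add: block_centred_def)
    also have "\<dots> = (\<Sum>c | var c = j. (A $ i $ c - p $ c) * y' i c)"
      by (simp add: sum_subtractf left_diff_distrib)
    finally show ?thesis
      using block_sum_centred(2)[OF p1, where y="y i" and j=j]
      unfolding entry[symmetric] sum_subtractf sum_divide_distrib[symmetric] y'_def
      by (simp add: diff_divide_distrib)
  qed
  \<comment> \<open>The set comprehension has the shape in which \<open>sum.group\<close> merges the
    blocks into one sum over all categories.\<close>
  have "taylor2 (loglik var x) z0 \<zeta> = loglik var x z0 + (\<Sum>i\<in>UNIV. \<Sum>j\<in>UNIV.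
      \<Sum>c\<in>{c \<in> UNIV. var c = j}. N / 2 * ((Z $ i $ c)\<^sup>2 - (Z $ i $ c - Y $ i $ c)\<^sup>2))"
    unfolding z0_def taylor2_loglik_predictor[OF cat obs]
    unfolding p_def[symmetric] z0_def[symmetric] y_def[symmetric] block by simp
  also have "\<dots> = loglik var x z0 + (\<Sum>i\<in>UNIV. \<Sum>c\<in>UNIV.
      N / 2 * ((Z $ i $ c)\<^sup>2 - (Z $ i $ c - Y $ i $ c)\<^sup>2))"
    by (subst sum.group) auto
  also have "\<dots> = loglik var x z0 + N / 2 * ((norm Z)\<^sup>2 - (norm (Z - Y))\<^sup>2)"
    unfolding sum_distrib_left[symmetric] sum_subtractf
    unfolding power2_norm_eq_inner inner_vec_def by (simp add: power2_eq_square)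
  finally show ?thesis unfolding N_def Z_def Y_def .
qed

text \<open>Equal coordinates force the predictors of each individual to differ by a constant on
  each block, which cancels in the softmax.\<close>

lemma model_prob_eq_if_mca_coordinates_eq:
  fixes var :: "'c::finite \<Rightarrow> 'm::finite" and x :: "'n::finite \<Rightarrow> 'm \<Rightarrow> 'c"
  assumes obs: "all_categories_observed var x"
    and eq: "mca_coordinates var x \<zeta> = mca_coordinates var x \<zeta>'"
  shows "model_prob var \<zeta> = model_prob var \<zeta>'"
proof (intro ext)
  fix i c
  define z0 :: "(real^'c) \<times> (real^'c^'n)" where "z0 = (log_proportions var x, 0)"
  define p where "p = proportions var x"
  \<comment> \<open>The difference of the two block means that centring removes.\<close>
  define a where "a = (\<Sum>c' | var c' = var c. p $ c' * predictor i c' (\<zeta> - z0))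
    - (\<Sum>c' | var c' = var c. p $ c' * predictor i c' (\<zeta>' - z0))"
  have shift: "predictor i c' \<zeta> = predictor i c' \<zeta>' + a" if "var c' = var c" for c'
  proof -
    have "mca_coordinates var x \<zeta> $ i $ c' = mca_coordinates var x \<zeta>' $ i $ c'"
      using eq by simp
    then show ?thesis
      using proportions_pos[OF obs, of c'] that
      by (simp add: mca_coordinates_def block_centred_def a_def p_def z0_def predictor_def)
  qed
  have "model_prob var \<zeta> i c = exp (predictor i c \<zeta>' + a)
      / (\<Sum>c' | var c' = var c. exp (predictor i c' \<zeta>' + a))"
    by (simp add: model_prob_predictor shift)
  also have "\<dots> = model_prob var \<zeta>' i c"
    by (simp add: model_prob_predictor exp_add flip: sum_distrib_right)
  finally show "model_prob var \<zeta> i c = model_prob var \<zeta>' i c" .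
qed

section \<open>Optimality of the MCA decomposition\<close>

text \<open>The cross term pairs \<open>v\<close> with the sum of the rows, which is zero.\<close>

lemma power2_norm_diff_constant_rows:
  fixes A :: "real^'c::finite^'n::finite"
  assumes "(\<Sum>i\<in>UNIV. A $ i) = 0"
  shows "(norm (A - (\<chi> i. v)))\<^sup>2 = (norm A)\<^sup>2 + real CARD('n) * (norm v)\<^sup>2"
proof -
  have "(norm (A $ i - v))\<^sup>2 = (norm (A $ i))\<^sup>2 - 2 * (A $ i \<bullet> v) + (norm v)\<^sup>2" for i
    by (simp add: power2_norm_eq_inner inner_diff_left inner_diff_right inner_commute)
  moreover have "(\<Sum>i\<in>UNIV. A $ i \<bullet> v) = 0"
    using assms by (simp flip: inner_sum_left)
  ultimately show ?thesis
    by (simp add: power2_norm_eq_sum_rows sum.distrib sum_subtractf flip: sum_distrib_left)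
qed

lemma rank_subtract_constant_rows_le:
  fixes A :: "real^'c::finite^'n::finite"
  assumes "v \<in> span (rows A)"
  shows "rank (\<chi> i. A $ i - v) \<le> rank A"
  unfolding row_rank_def
proof (rule dim_mono)
  have "A $ i \<in> span (rows A)" for i
    by (rule span_base) (simp add: rows_eq_range)
  then show "rows (\<chi> i. A $ i - v) \<subseteq> span (rows A)"
    using assms by (auto simp: rows_eq_range intro!: span_diff)
qed

definition row_mean :: "real^'c^'n::finite \<Rightarrow> real^'c" where
  "row_mean A = (1 / real CARD('n)) *\<^sub>R (\<Sum>i\<in>UNIV. A $ i)"

lemma row_mean_in_span: "row_mean A \<in> span (rows (A :: real^'c::finite^'n::finite))"
  unfolding row_mean_def
  by (intro span_scale span_sum span_base) (auto simp: rows_eq_range)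

lemma sum_centred_rows: "(\<Sum>i\<in>UNIV. (\<chi> i. A $ i - row_mean A) $ i) = (0 :: real^'c::finite)"
  for A :: "real^'c::finite^'n::finite"
  by (simp add: sum_subtractf row_mean_def sum_constant_scaleR del: sum_constant)

lemma sum_rows_pseudo_residual:
  fixes var :: "'c::finite \<Rightarrow> 'm::finite" and x :: "'n::finite \<Rightarrow> 'm \<Rightarrow> 'c"
  shows "(\<Sum>i\<in>UNIV. pseudo_residual var x $ i) = 0"
  by (simp add: vec_eq_iff pseudo_residual_entry sum_subtractf proportions_def
      flip: sum_divide_distrib)

text \<open>\<beta> adds the same row everywhere, so subtracting the mean row removes it. What
  remains is the row-centred \<Gamma> with rescaled columns, and row-centring cannot raise the rank
  because the mean lies in the row space.\<close>

lemma mca_coordinates_centred_rank: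
  fixes var :: "'c::finite \<Rightarrow> 'm::finite" and x :: "'n::finite \<Rightarrow> 'm \<Rightarrow> 'c"
  assumes "model_constraints var (proportions var x) K \<zeta>"
  shows "rank (\<chi> i. mca_coordinates var x \<zeta> $ i - row_mean (mca_coordinates var x \<zeta>)) \<le> K"
proof -
  define p where "p = proportions var x"
  define w :: "real^'c" where
    "w = (\<chi> c. sqrt (p $ c) / sqrt (real CARD('m) * real CARD('n)))"
  obtain \<beta> \<Gamma> where \<zeta>: "\<zeta> = (\<beta>, \<Gamma>)" by (cases \<zeta>)
  have \<Gamma>: "rank \<Gamma> \<le> K" "\<And>i j. (\<Sum>c | var c = j. p $ c * \<Gamma> $ i $ c) = 0"
    using assms by (auto simp: \<zeta> model_constraints_def p_def mult.commute)
  define b where "b = block_centred var p (\<lambda>c. \<beta> $ c - log_proportions var x $ c)"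
  let ?Y = "mca_coordinates var x \<zeta>"
  \<comment> \<open>The identifiability constraint makes block centring act on the \<beta> part
    only.\<close>
  have Y: "?Y $ i $ c = w $ c * (b c + \<Gamma> $ i $ c)" for i c
    using \<Gamma>(2)[of i "var c"]
    by (simp add: mca_coordinates_def w_def p_def \<zeta> b_def block_centred_def predictor_def
        sum.distrib ring_distribs add_divide_distrib diff_divide_distrib)
  have "row_mean ?Y $ c = w $ c * (b c + row_mean \<Gamma> $ c)" for c
    by (simp add: row_mean_def Y sum.distrib field_simps flip: sum_distrib_left)
  then have "(\<chi> i. ?Y $ i - row_mean ?Y) = (\<chi> i. \<Gamma> $ i - row_mean \<Gamma>) ** diag_matrix w"
    by (simp add: vec_eq_iff matrix_mul_diag_matrix Y algebra_simps)
  then have "rank (\<chi> i. ?Y $ i - row_mean ?Y) \<le> rank (\<chi> i. \<Gamma> $ i - row_mean \<Gamma>)"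
    by (simp add: rank_mul_le_left)
  also have "\<dots> \<le> rank \<Gamma>"
    by (intro rank_subtract_constant_rows_le row_mean_in_span)
  finally show ?thesis using \<Gamma>(1) by simp
qed

lemma mca_fit_optimal:
  fixes var :: "'c::finite \<Rightarrow> 'm::finite" and x :: "'n::finite \<Rightarrow> 'm \<Rightarrow> 'c"
  assumes svd: "is_svd (pseudo_residual var x) r U d V"
    and con: "model_constraints var (proportions var x) K \<zeta>"
  defines "Z \<equiv> pseudo_residual var x" and "Y \<equiv> mca_coordinates var x \<zeta>"
    and "T \<equiv> truncated_product K r U d V"
  shows "(norm (Z - T))\<^sup>2 \<le> (norm (Z - Y))\<^sup>2"
    and "K \<ge> 1 \<Longrightarrow> r \<le> K \<or> d K < d (K - 1) \<or> d K = 0 \<Longrightarrow>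
      (norm (Z - Y))\<^sup>2 \<le> (norm (Z - T))\<^sup>2 \<Longrightarrow> Y = T"
proof -
  define M where "M = (\<chi> i. Y $ i - row_mean Y)"
  have rk: "rank M \<le> K"
    unfolding M_def Y_def by (rule mca_coordinates_centred_rank[OF con])
  have YM: "Z - Y = (Z - M) - (\<chi> i. row_mean Y)"
    by (simp add: M_def vec_eq_iff)
  have "(\<Sum>i\<in>UNIV. (Z - M) $ i) = 0"
    using sum_centred_rows[of Y] sum_rows_pseudo_residual[of var x]
    by (simp add: sum_subtractf Z_def M_def)
  then have dist: "(norm (Z - Y))\<^sup>2 = (norm (Z - M))\<^sup>2 + real CARD('n) * (norm (row_mean Y))\<^sup>2"
    unfolding YM by (rule power2_norm_diff_constant_rows)
  have le: "(norm (Z - T))\<^sup>2 \<le> (norm (Z - M))\<^sup>2"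
    unfolding Z_def T_def by (rule eckart_young[OF svd rk])
  have nn: "0 \<le> real CARD('n) * (norm (row_mean Y))\<^sup>2" by simp
  show "(norm (Z - T))\<^sup>2 \<le> (norm (Z - Y))\<^sup>2"
    using dist le nn by linarith
  show "Y = T" if "K \<ge> 1" "r \<le> K \<or> d K < d (K - 1) \<or> d K = 0"
      and opt: "(norm (Z - Y))\<^sup>2 \<le> (norm (Z - T))\<^sup>2"
  proof -
    \<comment> \<open>Optimality collapses the chain from \<open>T\<close> through \<open>M\<close>
      to \<open>Y\<close>, so the mean row vanishes and \<open>M\<close> is itself a best
      approximation.\<close>
    have "real CARD('n) * (norm (row_mean Y))\<^sup>2 = 0" "(norm (Z - M))\<^sup>2 \<le> (norm (Z - T))\<^sup>2"
      using dist le nn opt by linarith+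
    then have "row_mean Y = 0" and "M = T"
      using eckart_young_unique[OF svd rk that(1,2)] by (auto simp: Z_def T_def)
    then show ?thesis by (simp add: M_def)
  qed
qed

text \<open>The vector \<open>q\<close>, equal to sqrt p on block \<open>j\<close> and 0 elsewhere,
  is annihilated by \<open>Z\<close>, since a row of \<open>A\<close> and \<open>p\<close> both sum
  to 1 on the block. Truncation preserves this, which yields the identifiability constraint.\<close>

lemma block_sum_truncated_product:
  fixes var :: "'c::finite \<Rightarrow> 'm::finite" and x :: "'n::finite \<Rightarrow> 'm \<Rightarrow> 'c"
  assumes cat: "categorical_data var x" and obs: "all_categories_observed var x"
    and svd: "is_svd (pseudo_residual var x) r U d V"
  shows "(\<Sum>c | var c = j. truncated_product K r U d V $ i $ c * sqrt (proportions var x $ c)) = 0"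
proof -
  define p where "p = proportions var x"
  define q :: "real^'c" where "q = (\<chi> c. if var c = j then sqrt (p $ c) else 0)"
  let ?Z = "pseudo_residual var x"
  have p: "0 < p $ c" for c unfolding p_def by (rule proportions_pos[OF obs])
  have inner_q: "q \<bullet> v = (\<Sum>c | var c = j. v $ c * sqrt (p $ c))" for v
  proof -
    have "q \<bullet> v = (\<Sum>c\<in>UNIV. if var c = j then v $ c * sqrt (p $ c) else 0)"
      unfolding inner_vec_def q_def by (intro sum.cong) auto
    then show ?thesis by (simp flip: sum.inter_filter)
  qed
  have "q \<bullet> ?Z $ i = 0" for i
  proof -
    have "q \<bullet> ?Z $ i = (\<Sum>c | var c = j.
        (indicator_matrix var x $ i $ c * 1 - p $ c) / sqrt (real CARD('m) * real CARD('n)))"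
      unfolding inner_q using p by (intro sum.cong) (auto simp: pseudo_residual_entry p_def less_imp_neq[THEN not_sym])
    then show ?thesis
      unfolding sum_divide_distrib[symmetric] sum_subtractf block_sum_indicator[OF cat]
      by (simp add: p_def block_sum_proportions[OF cat])
  qed
  then have "(\<Sum>k<r. (d k * (q \<bullet> V k))\<^sup>2) = 0"
    using svd sum_power2_inner_rows[of r U q d V] by (simp add: is_svd_def)
  \<comment> \<open>\<open>V k\<close> need not be orthogonal to \<open>q\<close> when
    \<open>d k = 0\<close>, but each term of the truncation carries the factor
    \<open>d k\<close>.\<close>
  then have "d k * (q \<bullet> V k) = 0" if "k < r" for k
    using that by (simp add: sum_nonneg_eq_0_iff)
  then have "q \<bullet> truncated_product K r U d V $ i = 0"
    unfolding truncated_product_zero_tail[of K] truncated_product_row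
    by (auto simp: inner_sum_right intro!: sum.neutral)
  then show ?thesis by (simp add: inner_q p_def)
qed

lemma from_mca_coordinates_entry:
  fixes var :: "'c::finite \<Rightarrow> 'm::finite" and x :: "'n::finite \<Rightarrow> 'm \<Rightarrow> 'c"
  shows "from_mca_coordinates var x M $ i $ c =
    sqrt (real CARD('m) * real CARD('n)) * (M $ i $ c / sqrt (proportions var x $ c))"
  by (simp add: from_mca_coordinates_def matrix_mul_diag_matrix)

lemma
  fixes var :: "'c::finite \<Rightarrow> 'm::finite" and x :: "'n::finite \<Rightarrow> 'm \<Rightarrow> 'c" and K :: nat
    and U :: "nat \<Rightarrow> real^'n" and d :: "nat \<Rightarrow> real" and V :: "nat \<Rightarrow> real^'c"
  assumes cat: "categorical_data var x" and obs: "all_categories_observed var x"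
    and svd: "is_svd (pseudo_residual var x) r U d V"
  defines "\<Gamma> \<equiv> from_mca_coordinates var x (truncated_product K r U d V)"
  shows model_constraints_from_mca_coordinates:
      "model_constraints var (proportions var x) K (\<beta>, \<Gamma>)"
    and mca_coordinates_from_mca_coordinates:
      "mca_coordinates var x (log_proportions var x, \<Gamma>) = truncated_product K r U d V"
proof -
  define T where "T = truncated_product K r U d V"
  define p where "p = proportions var x"
  define s where "s = sqrt (real CARD('m) * real CARD('n))"
  have s: "s \<noteq> 0" by (simp add: s_def)
  have p: "0 < p $ c" for c unfolding p_def by (rule proportions_pos[OF obs])
  have \<Gamma>: "\<Gamma> $ i $ c = s * (T $ i $ c / sqrt (p $ c))" for i c
    by (simp add: \<Gamma>_def from_mca_coordinates_entry T_def p_def s_def)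
  have sum0: "(\<Sum>c | var c = j. \<Gamma> $ i $ c * p $ c) = 0" for i j
  proof -
    \<comment> \<open>Dividing by sqrt p and weighting by p leaves the weight sqrt p of
      \<open>block_sum_truncated_product\<close>.\<close>
    have "\<Gamma> $ i $ c * p $ c = s * (T $ i $ c * sqrt (p $ c))" for c
      using real_div_sqrt[of "p $ c"] p[of c] by (simp add: \<Gamma> field_simps)
    then show ?thesis
      using block_sum_truncated_product[OF cat obs svd, where j=j and K=K and i=i]
      by (simp add: T_def p_def flip: sum_distrib_left)
  qed
  have "\<Gamma> = T ** diag_matrix (\<chi> c. s / sqrt (p $ c))"
    by (simp add: vec_eq_iff matrix_mul_diag_matrix \<Gamma>)
  then have "rank \<Gamma> \<le> rank T"
    by (simp add: rank_mul_le_left)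
  also have "rank T \<le> card (V ` {..<min K r})"
  proof (rule rank_le_if_rows_in_span)
    show "T $ i \<in> span (V ` {..<min K r})" for i
      unfolding T_def truncated_product_row by (intro span_sum span_scale span_base imageI)
  qed simp
  also have "\<dots> \<le> K"
    using card_image_le[of "{..<min K r}" V] by simp
  finally show "model_constraints var (proportions var x) K (\<beta>, \<Gamma>)"
    using sum0 by (simp add: model_constraints_def p_def)
  show "mca_coordinates var x (log_proportions var x, \<Gamma>) = truncated_product K r U d V"
    using sum0[of _ "var _"] p s
    by (simp add: vec_eq_iff mca_coordinates_def block_centred_def predictor_def mult.commute
        less_imp_neq[THEN not_sym] \<Gamma> flip: p_def s_def T_def)
qed

text \<open>Uniqueness concerns fitted probabilities because adding a constant to \<beta> on a block
  changes neither the approximation nor the constraints. At a positive tie between the last kept and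
  first discarded singular values, the truncation itself depends on the chosen
  decomposition.\<close>

theorem theorem2:
  fixes var :: "'c::finite \<Rightarrow> 'm::finite"
    and x :: "'n::finite \<Rightarrow> 'm \<Rightarrow> 'c"
    and K r :: nat
    and U :: "nat \<Rightarrow> real^'n" and d :: "nat \<Rightarrow> real" and V :: "nat \<Rightarrow> real^'c"
    and \<beta>\<^sub>0 :: "real^'c" and \<Gamma>_MCA :: "real^'c^'n"
  assumes "categorical_data var x"
    and "all_categories_observed var x"
    and "K \<ge> 1"
    and "is_svd (pseudo_residual var x) r U d V"
  defines "\<beta>\<^sub>0 \<equiv> log_proportions var x"
    and "\<Gamma>_MCA \<equiv> from_mca_coordinates var x (truncated_product K r U d V)"
  shows "one_step_estimate var x K (\<beta>\<^sub>0, 0) (\<beta>\<^sub>0, \<Gamma>_MCA)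
    \<and> (r \<le> K \<or> d K < d (K - 1) \<or> d K = 0 \<longrightarrow>
         (\<forall>\<zeta>. one_step_estimate var x K (\<beta>\<^sub>0, 0) \<zeta> \<longrightarrow>
               model_prob var \<zeta> = model_prob var (\<beta>\<^sub>0, \<Gamma>_MCA)))"
proof -
  note cat = assms(1) and obs = assms(2) and K = assms(3) and svd = assms(4)
  let ?Z = "pseudo_residual var x" and ?T = "truncated_product K r U d V"
  let ?\<zeta> = "(\<beta>\<^sub>0, \<Gamma>_MCA)"
  have Y: "mca_coordinates var x ?\<zeta> = ?T"
    unfolding \<beta>\<^sub>0_def \<Gamma>_MCA_def by (rule mca_coordinates_from_mca_coordinates[OF cat obs svd])
  have con: "model_constraints var (proportions var x) K ?\<zeta>"
    unfolding \<Gamma>_MCA_def by (rule model_constraints_from_mca_coordinates[OF cat obs svd])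
  \<comment> \<open>The common constant cancels and \<open>mn/2\<close> is positive, so maximizing
    the approximation is minimizing the distance to \<open>Z\<close>.\<close>
  have taylor2_le_iff: "taylor2 (loglik var x) (\<beta>\<^sub>0, 0) \<zeta> \<le> taylor2 (loglik var x) (\<beta>\<^sub>0, 0) \<zeta>' \<longleftrightarrow>
      (norm (?Z - mca_coordinates var x \<zeta>'))\<^sup>2 \<le> (norm (?Z - mca_coordinates var x \<zeta>))\<^sup>2" for \<zeta> \<zeta>'
    unfolding \<beta>\<^sub>0_def taylor2_loglik[OF cat obs] by simp
  have "one_step_estimate var x K (\<beta>\<^sub>0, 0) ?\<zeta>"
    using con mca_fit_optimal(1)[OF svd]
    by (auto simp: one_step_estimate_def is_arg_max_def not_less taylor2_le_iff Y)
  moreover have "model_prob var \<zeta> = model_prob var ?\<zeta>"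
    if gap: "r \<le> K \<or> d K < d (K - 1) \<or> d K = 0"
      and opt: "one_step_estimate var x K (\<beta>\<^sub>0, 0) \<zeta>" for \<zeta>
  proof -
    have "model_constraints var (proportions var x) K \<zeta>"
      using opt by (simp add: one_step_estimate_def is_arg_max_def)
    moreover have "taylor2 (loglik var x) (\<beta>\<^sub>0, 0) ?\<zeta> \<le> taylor2 (loglik var x) (\<beta>\<^sub>0, 0) \<zeta>"
      using opt con unfolding one_step_estimate_def is_arg_max_def not_ex not_less by force
    then have "(norm (?Z - mca_coordinates var x \<zeta>))\<^sup>2 \<le> (norm (?Z - ?T))\<^sup>2"
      unfolding taylor2_le_iff Y .
    ultimately have "mca_coordinates var x \<zeta> = ?T"
      using mca_fit_optimal(2)[OF svd _ K gap] by blast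
    then show ?thesis
      using Y by (intro model_prob_eq_if_mca_coordinates_eq[OF obs]) simp
  qed
  ultimately show ?thesis by blast
qed

end
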